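(* Let $E$ be a complex vector space of finite dimension $m\ge1$ with dual space $E^*$, let $\lambda\in\mathbb{C}$, let $\gamma:E\to E$ be an isomorphism, and let $\beta:E^*\to E^*$, $\mu:E^*\to E$ and $\eta:E^*\to\mathbb{C}$ be linear maps. Define a skew-symmetric bilinear bracket on $E\oplus E^*\oplus\mathbb{C}$ by $$[x+f+t,\;y+g+t']=g(x)-f(y)\in\mathbb{C}\qquad(x,y\in E,\ f,g\in E^*,\ t,t'\in\mathbb{C})$$ and $\alpha\in\mathrm{End}(E\oplus E^*\oplus\mathbb{C})$ by $$\alpha(x+f+t)=\gamma(x)+\beta(f)+\mu(f)+\eta(f)+\lambda t .$$ Then $(E\oplus E^*\oplus\mathbb{C},[\cdot,\cdot],\alpha)$ is a Heisenberg Hom-Lie algebra if and only if $$\beta\,{}^t\gamma=\lambda\,\mathrm{id}_{E^*}\qquad\text{and}\qquad {}^t\mu\,\beta={}^t\beta\,\mu .$$ Consequently, if $\mu=0$ and $\beta\,{}^t\gamma=\lambda\,\mathrm{id}_{E^*}$, then the extension $$0\longrightarrow(E^*\oplus\mathbb{C},\beta+\lambda)\longrightarrow(E\oplus E^*\oplus\mathbb{C},[\cdot,\cdot],\alpha)\longrightarrow(E,[\cdot,\cdot]_0,\gamma)\longrightarrow0$$ of the abelian Hom-Lie algebra $(E,[\cdot,\cdot]_0,\gamma)$ by the Hom-module $(E^*\oplus\mathbb{C},\beta+\lambda)$, in which $\alpha(x+f+t)=\gamma(x)+\beta(f)+\lambda t$, defines a Heisenberg Hom-Lie algebra.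
   Context: ${}^t\gamma:E^*\to E^*$ and ${}^t\mu:E^*\to E^{**}=E$, ${}^t\beta:E=E^{**}\to E^{**}=E$ denote transposes (with $E^{**}$ identified with $E$). $[\cdot,\cdot]_0$ is the zero bracket, and $\beta+\lambda$ denotes the map $f+t\mapsto\beta(f)+\lambda t$. A Hom-Lie algebra is a triple $(\mathcal{G},[\cdot,\cdot],\alpha)$ with $[\cdot,\cdot]$ skew-symmetric bilinear on the vector space $\mathcal{G}$ and $\alpha:\mathcal{G}\to\mathcal{G}$ linear, such that $[\alpha(x),[y,w]]+[\alpha(y),[w,x]]+[\alpha(w),[x,y]]=0$ for all $x,y,w$. It is multiplicative if $\alpha([x,y])=[\alpha(x),\alpha(y)]$. Its center is $Z(\mathcal{G})=\{x:[x,y]=0\ \forall y\}$; it is nilpotent if the series $\mathcal{G}_0=\mathcal{G}$, $\mathcal{G}_{n+1}=[\mathcal{G},\mathcal{G}_n]$ reaches $\{0\}$. A Heisenberg Hom-Lie algebra is a multiplicative nilpotent Hom-Lie algebra $\mathcal{H}$ with $\dim[\mathcal{H},\mathcal{H}]=1$ and $[\mathcal{H},\mathcal{H}]=Z(\mathcal{H})$. *)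

theory Defs
  imports Complex_Main "HOL-Library.Product_Plus"
begin

section \<open>Complex vector spaces\<close>

text \<open>
  The type-class counterpart of the locale \<open>vector_space\<close> over the complex numbers, in the style
  of the library's class \<open>real_vector\<close>.  A class (rather than the locale) is used so that
  the dual space can be a type.  No norm or topology is involved.
\<close>

class complex_vector = ab_group_add +
  fixes scaleC :: "complex \<Rightarrow> 'a \<Rightarrow> 'a" (infixr \<open>*\<^sub>C\<close> 75)
  assumes scaleC_add_right: "a *\<^sub>C (x + y) = a *\<^sub>C x + a *\<^sub>C y"
    and scaleC_add_left: "(a + b) *\<^sub>C x = a *\<^sub>C x + b *\<^sub>C x"
    and scaleC_scaleC: "a *\<^sub>C (b *\<^sub>C x) = (a * b) *\<^sub>C x"
    and scaleC_one: "1 *\<^sub>C x = x"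

global_interpretation complex_vector:
  vector_space "scaleC :: complex \<Rightarrow> 'a \<Rightarrow> 'a::complex_vector"
  by unfold_locales (rule scaleC_add_right scaleC_add_left scaleC_scaleC scaleC_one)+

abbreviation clinear :: "('a::complex_vector \<Rightarrow> 'b::complex_vector) \<Rightarrow> bool"
  where "clinear \<equiv> Vector_Spaces.linear scaleC scaleC"

global_interpretation complex_vector_pair:
  vector_space_pair "scaleC :: complex \<Rightarrow> 'a \<Rightarrow> 'a::complex_vector"
    "scaleC :: complex \<Rightarrow> 'b \<Rightarrow> 'b::complex_vector"
  ..

lemma clinear_iff:
  "clinear f \<longleftrightarrow> (\<forall>x y. f (x + y) = f x + f y) \<and> (\<forall>c x. f (c *\<^sub>C x) = c *\<^sub>C f x)"
  by (simp add: Vector_Spaces.linear_iff complex_vector.vector_space_axioms)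

definition cbilinear :: "('a::complex_vector \<Rightarrow> 'b::complex_vector \<Rightarrow> 'c::complex_vector) \<Rightarrow> bool"
  where "cbilinear b \<longleftrightarrow> (\<forall>x. clinear (b x)) \<and> (\<forall>y. clinear (\<lambda>x. b x y))"

instantiation complex :: complex_vector
begin
definition scaleC_complex_def [simp]: "scaleC a (x::complex) = a * x"
instance by standard (simp_all add: algebra_simps)
end

instantiation prod :: (complex_vector, complex_vector) complex_vector
begin
definition scaleC_prod_def: "scaleC a p = (a *\<^sub>C fst p, a *\<^sub>C snd p)"
instance
  by standard
    (simp_all add: scaleC_prod_def scaleC_add_right scaleC_add_left scaleC_scaleC scaleC_one)
end

section \<open>Dual spaces and transposes\<close>

typedef (overloaded) 'a dual = "{f :: 'a::complex_vector \<Rightarrow> complex. clinear f}"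
  morphisms dual_apply Abs_dual
  by (rule exI[of _ "\<lambda>_. 0"]) (simp add: clinear_iff)

lemma clinear_dual_apply: "clinear (dual_apply f)"
  using dual_apply by blast

lemma dual_apply_Abs: "clinear f \<Longrightarrow> dual_apply (Abs_dual f) = f"
  by (simp add: Abs_dual_inverse)

lemma dual_eqI: "(\<And>x. dual_apply f x = dual_apply g x) \<Longrightarrow> f = g"
  by (metis dual_apply_inject ext)

lemma dual_apply_add: "dual_apply f (x + y) = dual_apply f x + dual_apply f y"
  and dual_apply_scaleC: "dual_apply f (c *\<^sub>C x) = c * dual_apply f x"
  using clinear_dual_apply[of f] by (simp_all add: clinear_iff)

instantiation dual :: (complex_vector) complex_vector
begin
definition zero_dual_def: "0 = Abs_dual (\<lambda>_. 0)"
definition plus_dual_def: "f + g = Abs_dual (\<lambda>x. dual_apply f x + dual_apply g x)"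
definition minus_dual_def: "f - g = Abs_dual (\<lambda>x. dual_apply f x - dual_apply g x)"
definition uminus_dual_def: "- f = Abs_dual (\<lambda>x. - dual_apply f x)"
definition scaleC_dual_def: "c *\<^sub>C f = Abs_dual (\<lambda>x. c * dual_apply f x)"

lemma dual_apply_simps:
  "dual_apply 0 x = 0"
  "dual_apply (f + g) x = dual_apply f x + dual_apply g x"
  "dual_apply (f - g) x = dual_apply f x - dual_apply g x"
  "dual_apply (- f) x = - dual_apply f x"
  "dual_apply (c *\<^sub>C f) x = c * dual_apply f x"
  unfolding zero_dual_def plus_dual_def minus_dual_def uminus_dual_def scaleC_dual_def
  by (subst dual_apply_Abs,
      simp_all add: clinear_iff dual_apply_add dual_apply_scaleC algebra_simps)+

instance
  by standard (auto intro!: dual_eqI simp: dual_apply_simps algebra_simps)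
end

definition dual_map ::
  "('a::complex_vector \<Rightarrow> 'b::complex_vector) \<Rightarrow> 'b dual \<Rightarrow> 'a dual"
  where "dual_map h f = Abs_dual (dual_apply f \<circ> h)"

definition bidual_eval :: "'a::complex_vector \<Rightarrow> 'a dual dual"
  where "bidual_eval x = Abs_dual (\<lambda>f. dual_apply f x)"

text \<open>
  For a finite-dimensional space the evaluation map is the identification of the space with
  its bidual (bijectivity is proved below); \<open>inv bidual_eval\<close> is then its inverse.
  With this identification, maps from \<open>E*\<close> to \<open>E\<close> and from \<open>E*\<close> to \<open>E*\<close> have
  transposes from \<open>E*\<close> to \<open>E\<close> and from \<open>E\<close> to \<open>E\<close>, respectively.
\<close>

definition transpose_dual_to_space ::
  "('a::complex_vector dual \<Rightarrow> 'a) \<Rightarrow> 'a dual \<Rightarrow> 'a"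
  where "transpose_dual_to_space \<mu> = inv bidual_eval \<circ> dual_map \<mu>"

definition transpose_dual_to_dual ::
  "('a::complex_vector dual \<Rightarrow> 'a dual) \<Rightarrow> 'a \<Rightarrow> 'a"
  where "transpose_dual_to_dual \<beta> = inv bidual_eval \<circ> dual_map \<beta> \<circ> bidual_eval"

lemma dual_apply_dual_map: "clinear h \<Longrightarrow> dual_apply (dual_map h f) x = dual_apply f (h x)"
  unfolding dual_map_def
  by (subst dual_apply_Abs) (simp_all add: clinear_iff dual_apply_add dual_apply_scaleC)

lemma dual_apply_bidual_eval: "dual_apply (bidual_eval x) f = dual_apply f x"
  unfolding bidual_eval_def
  by (subst dual_apply_Abs) (simp_all add: clinear_iff dual_apply_simps)

lemma clinear_bidual_eval: "clinear bidual_eval"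
  unfolding clinear_iff
  by (auto intro!: dual_eqI
      simp: dual_apply_bidual_eval dual_apply_simps dual_apply_add dual_apply_scaleC)

lemma bij_bidual_eval:
  assumes "finite_dimensional_vector_space (scaleC :: complex \<Rightarrow> 'a \<Rightarrow> 'a::complex_vector) B"
  shows "bij (bidual_eval :: 'a \<Rightarrow> 'a dual dual)"
proof (rule bijI)
  interpret fd: finite_dimensional_vector_space "scaleC :: complex \<Rightarrow> 'a \<Rightarrow> 'a" B by fact
  define e where "e b = Abs_dual (\<lambda>x. complex_vector.representation B x b)" for b
  have scale: "(scaleC :: complex \<Rightarrow> complex \<Rightarrow> complex) = (*)"
    by (auto simp: fun_eq_iff)
  have e: "dual_apply (e b) x = complex_vector.representation B x b" for b x
    unfolding e_def
    using complex_vector.linear_representation[OF fd.independent_Basis fd.span_Basis]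
    by (subst dual_apply_Abs) (simp_all add: scale)
  have expand: "(\<Sum>b\<in>B. dual_apply (e b) x *\<^sub>C b) = x" for x
    unfolding e
    by (rule complex_vector.sum_representation_eq) (auto simp: fd.independent_Basis fd.span_Basis fd.finite_Basis)
  have apply_sum: "dual_apply f (sum g B) = (\<Sum>b\<in>B. dual_apply f (g b))"
    for f :: "'b::complex_vector dual" and g
    by (rule complex_vector_pair.linear_sum[OF clinear_dual_apply])
  have sum_apply: "dual_apply (sum g B) x = (\<Sum>b\<in>B. dual_apply (g b) x)"
    for x :: "'b::complex_vector" and g
    by (induction B rule: infinite_finite_induct) (simp_all add: dual_apply_simps)
  show "inj (bidual_eval :: 'a \<Rightarrow> 'a dual dual)"
  proof (rule injI)
    fix x y :: 'a
    assume "bidual_eval x = bidual_eval y"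
    then have "dual_apply f x = dual_apply f y" for f
      by (metis dual_apply_bidual_eval)
    then show "x = y" by (metis (no_types, lifting) expand sum.cong)
  qed
  show "surj (bidual_eval :: 'a \<Rightarrow> 'a dual dual)"
  proof (rule surjI)
    fix \<phi> :: "'a dual dual"
    show "bidual_eval (\<Sum>b\<in>B. dual_apply \<phi> (e b) *\<^sub>C b) = \<phi>"
    proof (rule dual_eqI)
      fix f :: "'a dual"
      have "f = (\<Sum>b\<in>B. dual_apply f b *\<^sub>C e b)"
      proof (rule dual_eqI)
        fix x
        have "dual_apply f x = dual_apply f (\<Sum>b\<in>B. dual_apply (e b) x *\<^sub>C b)"
          by (simp add: expand)
        then show "dual_apply f x = dual_apply (\<Sum>b\<in>B. dual_apply f b *\<^sub>C e b) x"
          by (simp add: apply_sum sum_apply dual_apply_simps dual_apply_scaleC mult.commute)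
      qed
      then have "dual_apply \<phi> f = dual_apply \<phi> (\<Sum>b\<in>B. dual_apply f b *\<^sub>C e b)"
        by simp
      then show "dual_apply (bidual_eval (\<Sum>b\<in>B. dual_apply \<phi> (e b) *\<^sub>C b)) f = dual_apply \<phi> f"
        by (simp add: dual_apply_bidual_eval apply_sum dual_apply_scaleC mult.commute)
    qed
  qed
qed

section \<open>Hom-Lie algebras\<close>

definition hom_lie_algebra ::
  "('g::complex_vector \<Rightarrow> 'g \<Rightarrow> 'g) \<Rightarrow> ('g \<Rightarrow> 'g) \<Rightarrow> bool"
  where "hom_lie_algebra br \<alpha> \<longleftrightarrow>
    cbilinear br \<and> (\<forall>x y. br x y = - br y x) \<and> clinear \<alpha> \<and>
    (\<forall>x y w. br (\<alpha> x) (br y w) + br (\<alpha> y) (br w x) + br (\<alpha> w) (br x y) = 0)"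

definition multiplicative :: "('g \<Rightarrow> 'g \<Rightarrow> 'g) \<Rightarrow> ('g \<Rightarrow> 'g) \<Rightarrow> bool"
  where "multiplicative br \<alpha> \<longleftrightarrow> (\<forall>x y. \<alpha> (br x y) = br (\<alpha> x) (\<alpha> y))"

definition lie_center :: "('g::complex_vector \<Rightarrow> 'g \<Rightarrow> 'g) \<Rightarrow> 'g set"
  where "lie_center br = {x. \<forall>y. br x y = 0}"

definition bracket_span :: "('g::complex_vector \<Rightarrow> 'g \<Rightarrow> 'g) \<Rightarrow> 'g set \<Rightarrow> 'g set \<Rightarrow> 'g set"
  where "bracket_span br A B = complex_vector.span {br x y | x y. x \<in> A \<and> y \<in> B}"

primrec lower_central_series :: "('g::complex_vector \<Rightarrow> 'g \<Rightarrow> 'g) \<Rightarrow> nat \<Rightarrow> 'g set"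
  where
    "lower_central_series br 0 = UNIV"
  | "lower_central_series br (Suc n) = bracket_span br UNIV (lower_central_series br n)"

definition lie_nilpotent :: "('g::complex_vector \<Rightarrow> 'g \<Rightarrow> 'g) \<Rightarrow> bool"
  where "lie_nilpotent br \<longleftrightarrow> (\<exists>n. lower_central_series br n = {0})"

definition heisenberg_hom_lie_algebra ::
  "('g::complex_vector \<Rightarrow> 'g \<Rightarrow> 'g) \<Rightarrow> ('g \<Rightarrow> 'g) \<Rightarrow> bool"
  where "heisenberg_hom_lie_algebra br \<alpha> \<longleftrightarrow>
    hom_lie_algebra br \<alpha> \<and> multiplicative br \<alpha> \<and> lie_nilpotent br \<and>
    complex_vector.dim (bracket_span br UNIV UNIV) = 1 \<and>
    bracket_span br UNIV UNIV = lie_center br"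

definition hom_lie_morphism ::
  "('g::complex_vector \<Rightarrow> 'g \<Rightarrow> 'g) \<Rightarrow> ('g \<Rightarrow> 'g) \<Rightarrow>
   ('h::complex_vector \<Rightarrow> 'h \<Rightarrow> 'h) \<Rightarrow> ('h \<Rightarrow> 'h) \<Rightarrow> ('g \<Rightarrow> 'h) \<Rightarrow> bool"
  where "hom_lie_morphism br \<alpha> br' \<alpha>' h \<longleftrightarrow>
    clinear h \<and> (\<forall>x y. h (br x y) = br' (h x) (h y)) \<and> (\<forall>x. h (\<alpha> x) = \<alpha>' (h x))"

abbreviation zero_bracket :: "'g::complex_vector \<Rightarrow> 'g \<Rightarrow> 'g"
  where "zero_bracket \<equiv> \<lambda>_ _. 0"

text \<open>
  A Hom-module of a Hom-Lie algebra is a vector space with a linear endomorphism \<open>\<phi>\<close> and an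
  action \<open>\<rho>\<close> that is a representation with respect to \<open>\<phi>\<close>.
\<close>

definition hom_module ::
  "('g::complex_vector \<Rightarrow> 'g \<Rightarrow> 'g) \<Rightarrow> ('g \<Rightarrow> 'g) \<Rightarrow>
   ('g \<Rightarrow> 'v::complex_vector \<Rightarrow> 'v) \<Rightarrow> ('v \<Rightarrow> 'v) \<Rightarrow> bool"
  where "hom_module br \<alpha> \<rho> \<phi> \<longleftrightarrow>
    cbilinear \<rho> \<and> clinear \<phi> \<and>
    (\<forall>x v. \<phi> (\<rho> x v) = \<rho> (\<alpha> x) (\<phi> v)) \<and>
    (\<forall>x y v. \<rho> (br x y) (\<phi> v) = \<rho> (\<alpha> x) (\<rho> y v) - \<rho> (\<alpha> y) (\<rho> x v))"

text \<open>
  Extension \<open>0 \<rightarrow> (V, \<phi>) \<rightarrow> (L, brL, \<alpha>L) \<rightarrow> (G, br, \<alpha>) \<rightarrow> 0\<close> by a Hom-module: \<open>V\<close> carries the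
  zero bracket, and the action of \<open>G\<close> on \<open>V\<close> is the one induced by the bracket of \<open>L\<close>.
\<close>

definition hom_lie_extension ::
  "('g::complex_vector \<Rightarrow> 'g \<Rightarrow> 'g) \<Rightarrow> ('g \<Rightarrow> 'g) \<Rightarrow>
   ('g \<Rightarrow> 'v::complex_vector \<Rightarrow> 'v) \<Rightarrow> ('v \<Rightarrow> 'v) \<Rightarrow>
   ('l::complex_vector \<Rightarrow> 'l \<Rightarrow> 'l) \<Rightarrow> ('l \<Rightarrow> 'l) \<Rightarrow>
   ('v \<Rightarrow> 'l) \<Rightarrow> ('l \<Rightarrow> 'g) \<Rightarrow> bool"
  where "hom_lie_extension br \<alpha> \<rho> \<phi> brL \<alpha>L i p \<longleftrightarrow>
    hom_lie_algebra br \<alpha> \<and> hom_module br \<alpha> \<rho> \<phi> \<and> hom_lie_algebra brL \<alpha>L \<and>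
    hom_lie_morphism zero_bracket \<phi> brL \<alpha>L i \<and> hom_lie_morphism brL \<alpha>L br \<alpha> p \<and>
    inj i \<and> range i = {u. p u = 0} \<and> surj p \<and>
    (\<forall>u v. brL u (i v) = i (\<rho> (p u) v))"

section \<open>The structure on the direct sum of \<open>E\<close>, \<open>E*\<close> and the complex numbers\<close>

text \<open>Elements \<open>x + f + t\<close> of the direct sum are triples \<open>(x, f, t)\<close>.\<close>

definition heis_bracket ::
  "'e::complex_vector \<times> 'e dual \<times> complex \<Rightarrow> 'e \<times> 'e dual \<times> complex \<Rightarrow> 'e \<times> 'e dual \<times> complex"
  where "heis_bracket = (\<lambda>(x, f, t) (y, g, t'). (0, 0, dual_apply g x - dual_apply f y))"

definition heis_twist ::
  "('e::complex_vector \<Rightarrow> 'e) \<Rightarrow> ('e dual \<Rightarrow> 'e dual) \<Rightarrow> ('e dual \<Rightarrow> 'e) \<Rightarrow> ('e dual \<Rightarrow> complex) \<Rightarrow>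
   complex \<Rightarrow> 'e \<times> 'e dual \<times> complex \<Rightarrow> 'e \<times> 'e dual \<times> complex"
  where "heis_twist \<gamma> \<beta> \<mu> \<eta> l = (\<lambda>(x, f, t). (\<gamma> x + \<mu> f, \<beta> f, \<eta> f + l * t))"

definition heis_module_map ::
  "('e::complex_vector dual \<Rightarrow> 'e dual) \<Rightarrow> complex \<Rightarrow> 'e dual \<times> complex \<Rightarrow> 'e dual \<times> complex"
  where "heis_module_map \<beta> l = (\<lambda>(f, t). (\<beta> f, l * t))"

definition heis_action ::
  "'e::complex_vector \<Rightarrow> 'e dual \<times> complex \<Rightarrow> 'e dual \<times> complex"
  where "heis_action x = (\<lambda>(f, t). (0, dual_apply f x))"

end

theory Submission
  imports Defs
begin

text \<open>
  Since the bracket takes values in the center \<open>\<complex>\<close> and ignores the \<open>\<complex>\<close>-component, all conditions of a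
  Heisenberg Hom-Lie algebra other than multiplicativity hold automatically.  Multiplicativity
  compares \<open>\<lambda> (g(x) - f(y))\<close> with \<open>\<beta>(g)(\<gamma>(x) + \<mu>(f)) - \<beta>(f)(\<gamma>(y) + \<mu>(g))\<close>; separating the
  variables gives \<open>\<^sup>t\<gamma> \<beta> = \<lambda>\<close>, which is \<open>\<beta> \<^sup>t\<gamma> = \<lambda>\<close> as \<open>\<^sup>t\<gamma>\<close> is bijective, and
  \<open>\<beta>(g)(\<mu>(f)) = \<beta>(f)(\<mu>(g))\<close>.
\<close>

section \<open>Duality, transposes and separation of points\<close>

lemma zero_triple: "(0, 0, 0) = 0"
  by (simp add: zero_prod_def)

lemma clinear_dual_map: "clinear h \<Longrightarrow> clinear (dual_map h)"
  unfolding clinear_iff[of "dual_map h"]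
  by (auto intro!: dual_eqI simp: dual_apply_dual_map dual_apply_simps)

text \<open>Transposition reverses composition, so the transpose of \<open>inv h\<close> is a
  two-sided inverse; for this \<open>inv h\<close> must first be shown linear.\<close>

lemma bij_dual_map:
  assumes h: "clinear h" and "bij h"
  shows "bij (dual_map h)"
proof -
  have inv_left: "inv h (h x) = x" and inv_right: "h (inv h y) = y" for x y
    using \<open>bij h\<close> by (simp_all add: bij_is_inj bij_is_surj surj_f_inv_f)
  \<comment> \<open>Linearity of \<open>h\<close> sends \<open>inv h x + inv h y\<close> to
    \<open>x + y\<close>; cancelling \<open>h\<close> by \<open>inv_left\<close> gives the
    claim.\<close>
  have "inv h (x + y) = inv h x + inv h y" for x y
    using h inv_left[of "inv h x + inv h y"] by (simp add: clinear_iff inv_right)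
  moreover have "inv h (c *\<^sub>C x) = c *\<^sub>C inv h x" for c x
    using h inv_left[of "c *\<^sub>C inv h x"] by (simp add: clinear_iff inv_right)
  ultimately have inv: "clinear (inv h)"
    by (simp add: clinear_iff)
  have "dual_map (inv h) (dual_map h f) = f" for f
    by (rule dual_eqI) (simp add: dual_apply_dual_map h inv inv_right)
  moreover have "dual_map h (dual_map (inv h) f) = f" for f
    by (rule dual_eqI) (simp add: dual_apply_dual_map h inv inv_left)
  ultimately show ?thesis
    by (intro o_bij[of "dual_map (inv h)"]) (auto simp: fun_eq_iff)
qed

text \<open>Bijectivity of evaluation makes \<open>inv bidual_eval\<close> a genuine inverse. With
  this rule and the next one, transposes are handled purely through pairings.\<close>

lemma dual_apply_transpose_dual_to_space:
  assumes "bij (bidual_eval :: 'a::complex_vector \<Rightarrow> 'a dual dual)" and "clinear (\<mu> :: 'a dual \<Rightarrow> 'a)"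
  shows "dual_apply g (transpose_dual_to_space \<mu> f) = dual_apply f (\<mu> g)"
  \<comment> \<open>The reversed evaluation rule is fixed at the functional \<open>g\<close>, since
    the unrestricted reversed equation would rewrite forever.\<close>
  by (simp add: transpose_dual_to_space_def surj_f_inv_f[OF bij_is_surj] assms dual_apply_dual_map
      flip: dual_apply_bidual_eval[of _ g])

lemma dual_apply_transpose_dual_to_dual:
  assumes "bij (bidual_eval :: 'a::complex_vector \<Rightarrow> 'a dual dual)" and "clinear (\<beta> :: 'a dual \<Rightarrow> 'a dual)"
  shows "dual_apply g (transpose_dual_to_dual \<beta> x) = dual_apply (\<beta> g) x"
proof -
  have "dual_apply (bidual_eval (transpose_dual_to_dual \<beta> x)) g = dual_apply (\<beta> g) x"
    by (simp add: transpose_dual_to_dual_def surj_f_inv_f[OF bij_is_surj] assms dual_apply_dual_map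
        dual_apply_bidual_eval)
  then show ?thesis by (simp add: dual_apply_bidual_eval)
qed

text \<open>This is injectivity of the evaluation map. It turns equalities in E into equalities of
  scalars and yields a functional that is nonzero on a given nonzero vector.\<close>

lemma dual_separates:
  assumes "bij (bidual_eval :: 'a::complex_vector \<Rightarrow> 'a dual dual)"
    and "\<And>f. dual_apply f x = dual_apply f (y :: 'a)"
  shows "x = y"
proof (rule injD[OF bij_is_inj[OF assms(1)]])
  show "bidual_eval x = bidual_eval y"
    by (rule dual_eqI) (simp add: dual_apply_bidual_eval assms(2))
qed

lemma clinear_0: "clinear h \<Longrightarrow> h 0 = 0"
  by (rule complex_vector_pair.linear_0)

section \<open>The bracket and the twist: center, derived algebra, nilpotency\<close>

lemma heis_bracket_simp [simp]:
  "heis_bracket (x, f, t) (y, g, t') = (0, 0, dual_apply g x - dual_apply f y)"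
  by (simp add: heis_bracket_def)

lemma dual_apply_0_right: "dual_apply f 0 = 0"
  by (rule clinear_0[OF clinear_dual_apply])

lemma heis_twist_simp [simp]:
  "heis_twist \<gamma> \<beta> \<mu> \<eta> l (x, f, t) = (\<gamma> x + \<mu> f, \<beta> f, \<eta> f + l * t)"
  by (simp add: heis_twist_def)

lemma cbilinear_heis_bracket: "cbilinear heis_bracket"
  by (auto simp: cbilinear_def clinear_iff scaleC_prod_def dual_apply_simps dual_apply_add
      dual_apply_scaleC algebra_simps)

lemma clinear_heis_twist:
  assumes "clinear \<gamma>" "clinear \<beta>" "clinear \<mu>" "clinear \<eta>"
  shows "clinear (heis_twist \<gamma> \<beta> \<mu> \<eta> l)"
  using assms by (auto simp: clinear_iff scaleC_prod_def scaleC_add_right algebra_simps)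

lemma hom_lie_algebra_heis:
  assumes "clinear \<gamma>" "clinear \<beta>" "clinear \<mu>" "clinear \<eta>"
  shows "hom_lie_algebra heis_bracket (heis_twist \<gamma> \<beta> \<mu> \<eta> l)"
  unfolding hom_lie_algebra_def
  using cbilinear_heis_bracket clinear_heis_twist[OF assms]
  by (auto simp: dual_apply_simps dual_apply_0_right zero_triple)

lemma lie_center_heis:
  assumes "bij (bidual_eval :: 'e::complex_vector \<Rightarrow> 'e dual dual)"
  shows "lie_center (heis_bracket :: 'e \<times> 'e dual \<times> complex \<Rightarrow> _) = range (\<lambda>t. (0, 0, t))"
proof (intro equalityI subsetI)
  fix u :: "'e \<times> 'e dual \<times> complex"
  assume u: "u \<in> lie_center heis_bracket"
  obtain x f t where [simp]: "u = (x, f, t)" by (cases u)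
  have eq: "dual_apply g x = dual_apply f y" for y g
    using u by (auto simp: lie_center_def simp flip: zero_triple)
  \<comment> \<open>The pairing is nondegenerate on both sides: testing with \<open>g = 0\<close>
    kills \<open>f\<close>, and testing with \<open>y = 0\<close> leaves \<open>g(x) = 0\<close> for
    all \<open>g\<close>.\<close>
  have "f = 0"
    using eq[of 0] by (auto intro!: dual_eqI simp: dual_apply_simps)
  moreover have "x = 0"
    using eq[of _ 0] by (intro dual_separates[OF assms]) (simp add: dual_apply_0_right)
  ultimately show "u \<in> range (\<lambda>t. (0, 0, t))" by simp
qed (auto simp: lie_center_def dual_apply_simps dual_apply_0_right zero_triple)

text \<open>Presenting the central line as the span of one nonzero vector makes both its closure
  under span and its dimension immediate.\<close>

lemma span_heis_center:
  "complex_vector.span {(0, 0, 1 :: complex)} = range (\<lambda>t :: complex. (0 :: 'e::complex_vector, 0 :: 'e dual, t))"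
  by (simp add: complex_vector.span_singleton scaleC_prod_def)

text \<open>The brackets already fill a whole line, so taking the span adds nothing. The vector
  \<open>x0\<close> records E \<noteq> 0; for E = 0 the bracket would vanish.\<close>

lemma bracket_span_heis:
  assumes "bij (bidual_eval :: 'e::complex_vector \<Rightarrow> 'e dual dual)" and "(x0 :: 'e) \<noteq> 0"
  shows "bracket_span heis_bracket UNIV UNIV = range (\<lambda>t :: complex. (0 :: 'e, 0 :: 'e dual, t))"
proof -
  obtain f where f: "dual_apply f x0 \<noteq> 0"
    using dual_separates[OF assms(1), of x0 0] assms(2) by (auto simp: dual_apply_0_right)
  have "{heis_bracket u v |u v. u \<in> UNIV \<and> v \<in> UNIV} = range (\<lambda>t :: complex. (0 :: 'e, 0 :: 'e dual, t))"
  proof (intro equalityI subsetI)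
    fix w assume "w \<in> range (\<lambda>t :: complex. (0 :: 'e, 0 :: 'e dual, t))"
    then obtain t where "w = (0, 0, t)" by auto
    \<comment> \<open>The vector \<open>x0\<close> is rescaled so that \<open>f\<close> takes the
      value \<open>t\<close> on it.\<close>
    then have "w = heis_bracket ((t / dual_apply f x0) *\<^sub>C x0, 0, 0) (0, f, 0)"
      using f by (simp add: dual_apply_simps dual_apply_scaleC)
    then show "w \<in> {heis_bracket u v |u v. u \<in> UNIV \<and> v \<in> UNIV}" by blast
  qed auto
  then show ?thesis
    by (simp only: bracket_span_def complex_vector.span_span flip: span_heis_center)
qed

lemma lie_nilpotent_heis:
  assumes "bij (bidual_eval :: 'e::complex_vector \<Rightarrow> 'e dual dual)" and "(x0 :: 'e) \<noteq> 0"
  shows "lie_nilpotent (heis_bracket :: 'e \<times> 'e dual \<times> complex \<Rightarrow> _)"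
  unfolding lie_nilpotent_def
proof
  have zero: "heis_bracket u (0, 0, t) = 0" for u :: "'e \<times> 'e dual \<times> complex" and t
    by (cases u) (simp add: dual_apply_simps dual_apply_0_right zero_triple)
  have "{heis_bracket u v |u v. u \<in> UNIV \<and> v \<in> range (\<lambda>t :: complex. (0 :: 'e, 0 :: 'e dual, t))} = {0}"
    using zero zero[symmetric] by blast
  \<comment> \<open>The term of index 1 is the central line, so the term of index 2
    vanishes.\<close>
  then show "lower_central_series (heis_bracket :: 'e \<times> 'e dual \<times> complex \<Rightarrow> _) (Suc (Suc 0)) = {0}"
    by (simp add: bracket_span_heis[OF assms]) (simp add: bracket_span_def)
qed

lemma heisenberg_iff_multiplicative:
  assumes "bij (bidual_eval :: 'e::complex_vector \<Rightarrow> 'e dual dual)" and "(x0 :: 'e) \<noteq> 0"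
    and "clinear (\<gamma> :: 'e \<Rightarrow> 'e)" "clinear \<beta>" "clinear \<mu>" "clinear \<eta>"
  shows "heisenberg_hom_lie_algebra heis_bracket (heis_twist \<gamma> \<beta> \<mu> \<eta> l) \<longleftrightarrow>
    multiplicative heis_bracket (heis_twist \<gamma> \<beta> \<mu> \<eta> l)"
proof -
  have "complex_vector.dim (range (\<lambda>t :: complex. (0 :: 'e, 0 :: 'e dual, t))) = 1"
    by (simp add: complex_vector.dim_eq_card_independent zero_prod_def flip: span_heis_center)
  then show ?thesis
    by (simp add: heisenberg_hom_lie_algebra_def hom_lie_algebra_heis assms(3-)
        lie_nilpotent_heis[OF assms(1,2)] bracket_span_heis[OF assms(1,2)] lie_center_heis[OF assms(1)])
qed

section \<open>The two conditions on \<beta>, \<gamma> and \<mu> as scalar identities\<close>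

lemma compose_dual_map_scale_iff:
  assumes "clinear \<gamma>" "bij \<gamma>" and "clinear \<beta>"
  shows "\<beta> \<circ> dual_map \<gamma> = (\<lambda>f. l *\<^sub>C f) \<longleftrightarrow> (\<forall>g x. dual_apply (\<beta> g) (\<gamma> x) = l * dual_apply g x)"
proof -
  let ?t = "dual_map \<gamma>"
  have t: "bij ?t" "?t (l *\<^sub>C f) = l *\<^sub>C ?t f" for f
    using bij_dual_map[OF assms(1,2)] clinear_dual_map[OF assms(1)] by (auto simp: clinear_iff)
  \<comment> \<open>The order of the factors is swapped via
    \<open>?t \<circ> \<beta> \<circ> ?t\<close>: injectivity of \<open>?t\<close> cancels it on the
    left here, and surjectivity cancels it on the right in the next step. This also covers
    \<open>l = 0\<close>.\<close>
  have "(\<forall>f. \<beta> (?t f) = l *\<^sub>C f) \<longleftrightarrow> (\<forall>f. ?t (\<beta> (?t f)) = l *\<^sub>C ?t f)"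
    by (metis t bij_is_inj injD)
  also have "\<dots> \<longleftrightarrow> (\<forall>g. ?t (\<beta> g) = l *\<^sub>C g)"
    by (metis t(1) bij_pointE)
  also have "\<dots> \<longleftrightarrow> (\<forall>g x. dual_apply (?t (\<beta> g)) x = dual_apply (l *\<^sub>C g) x)"
    by (metis dual_eqI)
  finally show ?thesis
    by (simp add: fun_eq_iff dual_apply_dual_map assms(1) dual_apply_simps)
qed

text \<open>Testing both maps into E against every functional moves the transposes across the
  pairing; what remains is symmetry of the bilinear form sending (f, g) to
  \<beta>(f)(\<mu>(g)).\<close>

lemma transpose_commute_iff:
  assumes "bij (bidual_eval :: 'e::complex_vector \<Rightarrow> 'e dual dual)"
    and "clinear (\<beta> :: 'e dual \<Rightarrow> 'e dual)" "clinear \<mu>"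
  shows "transpose_dual_to_space \<mu> \<circ> \<beta> = transpose_dual_to_dual \<beta> \<circ> \<mu> \<longleftrightarrow>
    (\<forall>f g. dual_apply (\<beta> f) (\<mu> g) = dual_apply (\<beta> g) (\<mu> f))"
proof -
  have "transpose_dual_to_space \<mu> \<circ> \<beta> = transpose_dual_to_dual \<beta> \<circ> \<mu> \<longleftrightarrow>
      (\<forall>f g. dual_apply g (transpose_dual_to_space \<mu> (\<beta> f)) = dual_apply g (transpose_dual_to_dual \<beta> (\<mu> f)))"
    unfolding fun_eq_iff o_def by (auto intro: dual_separates[OF assms(1)])
  then show ?thesis
    by (simp add: dual_apply_transpose_dual_to_space dual_apply_transpose_dual_to_dual assms)
qed

lemma multiplicative_heis_iff:
  assumes "clinear \<gamma>" "clinear \<beta>" "clinear \<mu>" "clinear \<eta>"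
  shows "multiplicative heis_bracket (heis_twist \<gamma> \<beta> \<mu> \<eta> l) \<longleftrightarrow>
    (\<forall>g x. dual_apply (\<beta> g) (\<gamma> x) = l * dual_apply g x) \<and>
    (\<forall>f g. dual_apply (\<beta> f) (\<mu> g) = dual_apply (\<beta> g) (\<mu> f))"
    (is "?M \<longleftrightarrow> ?A \<and> ?B")
proof -
  note zero = assms[THEN clinear_0]
  \<comment> \<open>Only the scalar component carries information. The map \<eta> disappears: on the
    left it is evaluated at 0, and on the right the bracket ignores scalar components.\<close>
  have M: "?M \<longleftrightarrow> (\<forall>x f y g. l * (dual_apply g x - dual_apply f y) =
      dual_apply (\<beta> g) (\<gamma> x + \<mu> f) - dual_apply (\<beta> f) (\<gamma> y + \<mu> g))"
    by (simp add: multiplicative_def zero)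
  show ?thesis
  proof
    assume ?M
    then have eq: "l * (dual_apply g x - dual_apply f y) =
      dual_apply (\<beta> g) (\<gamma> x + \<mu> f) - dual_apply (\<beta> f) (\<gamma> y + \<mu> g)" for x f y g
      by (simp add: M)
    show "?A \<and> ?B"
      \<comment> \<open>Setting \<open>f = 0\<close> and \<open>y = 0\<close> isolates
        \<open>?A\<close>; setting \<open>x = 0\<close> and \<open>y = 0\<close> isolates
        \<open>?B\<close>.\<close>
      using eq[of _ _ 0 0] eq[of _ 0 _ 0]
      by (auto simp: zero dual_apply_simps dual_apply_0_right)
  next
    assume "?A \<and> ?B"
    then show ?M
      unfolding M by (auto simp: dual_apply_add algebra_simps)
  qed
qed

section \<open>The extension and the final equivalence\<close>

lemma hom_lie_extension_heis:
  assumes "clinear (\<gamma> :: 'e::complex_vector \<Rightarrow> 'e)" "clinear \<beta>"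
    and eq: "\<And>g x. dual_apply (\<beta> g) (\<gamma> x) = l * dual_apply g x"
  shows "hom_lie_extension zero_bracket \<gamma> heis_action (heis_module_map \<beta> l)
    heis_bracket (heis_twist \<gamma> \<beta> (\<lambda>_. 0) (\<lambda>_. 0) l) (\<lambda>v. (0, v)) fst"
proof -
  note zero = assms(1,2)[THEN clinear_0]
  have "clinear (\<lambda>_ :: 'e dual. 0 :: 'e)" "clinear (\<lambda>_ :: 'e dual. 0 :: complex)"
    by (simp_all add: clinear_iff)
  then have "hom_lie_algebra heis_bracket (heis_twist \<gamma> \<beta> (\<lambda>_. 0) (\<lambda>_. 0) l)"
    using assms(1,2) by (intro hom_lie_algebra_heis)
  moreover have "hom_lie_algebra zero_bracket \<gamma>"
    using assms(1) by (simp add: hom_lie_algebra_def cbilinear_def clinear_iff)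
  \<comment> \<open>Compatibility of the action with the twists is exactly \<open>eq\<close>. The
    representation identity is trivial, because the bracket on E is zero and two successive actions
    give 0.\<close>
  moreover have "hom_module zero_bracket \<gamma> heis_action (heis_module_map \<beta> l)"
    using assms(1,2)
    by (auto simp: hom_module_def cbilinear_def clinear_iff heis_action_def heis_module_map_def
        scaleC_prod_def dual_apply_simps dual_apply_add dual_apply_scaleC dual_apply_0_right
        zero eq zero_prod_def algebra_simps)
  moreover have "hom_lie_morphism zero_bracket (heis_module_map \<beta> l) heis_bracket
      (heis_twist \<gamma> \<beta> (\<lambda>_. 0) (\<lambda>_. 0) l) (\<lambda>v. (0, v))"
    by (auto simp: hom_lie_morphism_def clinear_iff heis_module_map_def scaleC_prod_def
        dual_apply_0_right zero zero_prod_def)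
  moreover have "hom_lie_morphism heis_bracket (heis_twist \<gamma> \<beta> (\<lambda>_. 0) (\<lambda>_. 0) l)
      zero_bracket \<gamma> fst"
    by (auto simp: hom_lie_morphism_def clinear_iff scaleC_prod_def)
  moreover have "range (\<lambda>v. (0, v)) = {u :: 'e \<times> 'e dual \<times> complex. fst u = 0}"
    by (auto simp: image_iff)
  \<comment> \<open>The functional component of \<open>u\<close> pairs only with the E-component of
    the second argument, which is 0, so the bracket depends on \<open>u\<close> only through its
    image in E.\<close>
  moreover have "heis_bracket u (0, v) = (0, heis_action (fst u) v)" for u :: "'e \<times> 'e dual \<times> complex" and v
    by (cases u, cases v) (simp add: heis_action_def dual_apply_0_right)
  ultimately show ?thesis
    by (auto simp: hom_lie_extension_def inj_on_def surj_def)
qed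

theorem theorem3p13:
  fixes m :: nat
    and l :: complex
    and \<gamma> :: "'e::complex_vector \<Rightarrow> 'e"
    and \<beta> :: "'e dual \<Rightarrow> 'e dual"
    and \<mu> :: "'e dual \<Rightarrow> 'e"
    and \<eta> :: "'e dual \<Rightarrow> complex"
  assumes "\<exists>B. finite_dimensional_vector_space (scaleC :: complex \<Rightarrow> 'e \<Rightarrow> 'e) B"
    and "complex_vector.dim (UNIV :: 'e set) = m" and "m \<ge> 1"
    and "clinear \<gamma>" and "bij \<gamma>"
    and "clinear \<beta>" and "clinear \<mu>" and "clinear \<eta>"
  shows "(heisenberg_hom_lie_algebra heis_bracket (heis_twist \<gamma> \<beta> \<mu> \<eta> l) \<longleftrightarrow>
           \<beta> \<circ> dual_map \<gamma> = (\<lambda>f. l *\<^sub>C f) \<and>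
           transpose_dual_to_space \<mu> \<circ> \<beta> = transpose_dual_to_dual \<beta> \<circ> \<mu>)
       \<and> (\<mu> = (\<lambda>_. 0) \<and> \<beta> \<circ> dual_map \<gamma> = (\<lambda>f. l *\<^sub>C f) \<longrightarrow>
           (let \<alpha> = heis_twist \<gamma> \<beta> \<mu> (\<lambda>_. 0) l in
             (\<forall>x f t. \<alpha> (x, f, t) = (\<gamma> x, \<beta> f, l * t)) \<and>
             hom_lie_extension zero_bracket \<gamma> heis_action (heis_module_map \<beta> l)
               heis_bracket \<alpha> (\<lambda>v. (0, v)) fst \<and>
             heisenberg_hom_lie_algebra heis_bracket \<alpha>))"
proof -
  have bij: "bij (bidual_eval :: 'e \<Rightarrow> 'e dual dual)"
    using assms(1) bij_bidual_eval by blast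
  obtain x0 :: 'e where x0: "x0 \<noteq> 0"
  proof (rule ccontr)
    assume "\<not> thesis"
    with that have "(UNIV :: 'e set) = {0}" by blast
    \<comment> \<open>If every vector were zero, the empty set would be a basis, contradicting
      \<open>m \<ge> 1\<close>.\<close>
    then have "m = card ({} :: 'e set)"
      using assms(2) complex_vector.dim_unique[of "{}" "UNIV :: 'e set" 0]
      by (simp add: complex_vector.independent_empty)
    then show False using assms(3) by simp
  qed
  \<comment> \<open>Stated for arbitrary \<open>\<eta>'\<close>, since it is applied both to \<eta>
    and to the zero map of the extension.\<close>
  have iff: "heisenberg_hom_lie_algebra heis_bracket (heis_twist \<gamma> \<beta> \<mu> \<eta>' l) \<longleftrightarrow>
      \<beta> \<circ> dual_map \<gamma> = (\<lambda>f. l *\<^sub>C f) \<and>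
      transpose_dual_to_space \<mu> \<circ> \<beta> = transpose_dual_to_dual \<beta> \<circ> \<mu>" if "clinear \<eta>'" for \<eta>'
    unfolding heisenberg_iff_multiplicative[OF bij x0 assms(4,6,7) that]
      multiplicative_heis_iff[OF assms(4,6,7) that]
      compose_dual_map_scale_iff[OF assms(4-6)] transpose_commute_iff[OF bij assms(6,7)] ..
  have 0: "clinear (\<lambda>_ :: 'e dual. 0 :: complex)"
    by (simp add: clinear_iff)
  have "hom_lie_extension zero_bracket \<gamma> heis_action (heis_module_map \<beta> l)
      heis_bracket (heis_twist \<gamma> \<beta> \<mu> (\<lambda>_. 0) l) (\<lambda>v. (0, v)) fst \<and>
      heisenberg_hom_lie_algebra heis_bracket (heis_twist \<gamma> \<beta> \<mu> (\<lambda>_. 0) l)"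
    if \<mu>: "\<mu> = (\<lambda>_. 0)" and \<beta>: "\<beta> \<circ> dual_map \<gamma> = (\<lambda>f. l *\<^sub>C f)"
  proof
    show "hom_lie_extension zero_bracket \<gamma> heis_action (heis_module_map \<beta> l)
        heis_bracket (heis_twist \<gamma> \<beta> \<mu> (\<lambda>_. 0) l) (\<lambda>v. (0, v)) fst"
      unfolding \<mu> using \<beta> compose_dual_map_scale_iff[OF assms(4-6)]
      by (intro hom_lie_extension_heis assms(4,6)) simp
    show "heisenberg_hom_lie_algebra heis_bracket (heis_twist \<gamma> \<beta> \<mu> (\<lambda>_. 0) l)"
      \<comment> \<open>For \<mu> = 0 both sides of the symmetry condition are functionals evaluated
        at 0.\<close>
      unfolding iff[OF 0] transpose_commute_iff[OF bij assms(6,7)]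
      using \<beta> by (simp add: \<mu> dual_apply_0_right)
  qed
  with iff[OF assms(8)] show ?thesis
    by (simp add: Let_def)
qed

end
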